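(* Let $G$ be the grid defined in the context. For all integers $0\le j<i$ and every $x\in\{[G(i,k)]_3:k\ge0\}$ (the base-3 values of row $i$), there exist $a,b\in\{[G(j,k)]_3:k\ge0\}$ (base-3 values of row $j$) with $a<b<x$ and $b-a=x-b$; that is, $x$ is the last term of a 3-term arithmetic progression whose first two terms are base-3 values of strings in row $j$.
   Context: For a finite string $w=a_na_{n-1}\cdots a_0$ over digits $\{0,1,2\}$ let $[w]_{3/2}=\sum_k a_k(3/2)^k$ and $[w]_3=\sum_k a_k3^k$. Define an operation $T$ on such strings ("adding 2 in base $\frac32$"): if $w$ contains no digit $0$, first replace $w$ by $0w$; then change the rightmost $0$ of $w$ into $2$, change every digit to the right of it by $1\mapsto0$, $2\mapsto1$, and leave all digits to the left of it unchanged. Then $[T(w)]_{3/2}=[w]_{3/2}+2$. The grid $G$ has entries $G(i,j)$ (row $i$, column $j$, $i,j\ge0$): $G(0,j)$ is the binary representation of $j$ (so row $0$ is $0,1,10,11,100,\dots$), and $G(i+1,j)=T(G(i,j))$. *)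

theory Defs
  imports Complex_Main
begin

text \<open>
  A digit string \<open>a\<^sub>n \<dots> a\<^sub>0\<close> is the list \<open>[a\<^sub>0, \<dots>, a\<^sub>n]\<close>: least significant digit first, so that
  \<open>w ! k\<close> is the digit \<open>a\<^sub>k\<close>, rightmost means first in the list, and a zero prefixed to the string
  is appended to the list.
\<close>

definition str_value :: "'a::comm_semiring_1 \<Rightarrow> nat list \<Rightarrow> 'a" where
  "str_value \<beta> w = (\<Sum>k<length w. of_nat (w ! k) * \<beta> ^ k)"

text \<open>The number zero is written as the one-digit string \<open>0\<close>, not as the empty string.\<close>

fun binary :: "nat \<Rightarrow> nat list" where
  "binary n = (if n < 2 then [n] else n mod 2 # binary (n div 2))"

declare binary.simps [simp del]

definition add_two :: "nat list \<Rightarrow> nat list" where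
  "add_two w =
    (let v = (if 0 \<in> set w then w else w @ [0])
     in map (\<lambda>d. d - 1) (takeWhile (\<lambda>d. d \<noteq> 0) v) @ 2 # tl (dropWhile (\<lambda>d. d \<noteq> 0) v))"

fun grid :: "nat \<Rightarrow> nat \<Rightarrow> nat list" where
  "grid 0 j = binary j"
| "grid (Suc i) j = add_two (grid i j)"

definition row_values :: "nat \<Rightarrow> int set" where
  "row_values i = {str_value 3 (grid i k) | k. True}"

lemma str_value_Nil [simp]: "str_value \<beta> [] = 0"
  by (simp add: str_value_def)

lemma str_value_Cons [simp]: "str_value \<beta> (d # w) = of_nat d + \<beta> * str_value \<beta> w"
  by (simp add: str_value_def sum.lessThan_Suc_shift sum_distrib_left algebra_simps
      del: sum.lessThan_Suc)

lemma add_two_simps: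
  "add_two [] = [2]"
  "add_two (d # w) = (if d = 0 then 2 # w else (d - 1) # add_two w)"
  by (auto simp: add_two_def Let_def)

lemma str_value_add_two: "str_value (3/2 :: real) (add_two w) = str_value (3/2) w + 2"
  by (induction w) (auto simp: add_two_simps of_nat_diff algebra_simps)

lemma str_value_binary: "str_value 2 (binary n) = n"
proof (induction n rule: binary.induct)
  case (1 n)
  then show ?case
    by (subst binary.simps) auto
qed

lemma set_binary: "set (binary n) \<subseteq> {0, 1}"
proof (induction n rule: binary.induct)
  case (1 n)
  then show ?case
    by (subst binary.simps) auto
qed

lemma set_add_two: "set w \<subseteq> {0, 1, 2} \<Longrightarrow> set (add_two w) \<subseteq> {0, 1, 2}"
  by (induction w) (auto simp: add_two_simps)

lemma set_grid: "set (grid i j) \<subseteq> {0, 1, 2}"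
proof (induction i)
  case 0
  show ?case using set_binary[of j] by auto
next
  case (Suc i)
  then show ?case using set_add_two by simp
qed

end

theory Submission
  imports Defs
begin

text \<open>
  Every natural number \<open>x\<close> is the base-3 value of strings in exactly one row of the grid, and that
  row is computed digit by digit: if \<open>y\<close> lies in row \<open>r\<close>, then \<open>3y + d\<close> lies in row
  \<open>\<lfloor>(3r + d) / 2\<rfloor>\<close>. Hence the elements of row \<open>p\<close> arise by appending the digit \<open>n mod 3\<close>
  to an element of row \<open>n div 3\<close>, where \<open>n \<in> {2p, 2p + 1}\<close>. Solving \<open>a + x = 2b\<close> from the
  last digit upwards, with carries in \<open>{-1, 0, 1}\<close>, leads to the same equation for shorter
  strings, with \<open>a\<close> and \<open>b\<close> in rows that differ by at most one. Finitely many
  such subproblems, each asking for one of several carries and rows, suffice for an induction on \<open>x\<close>.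
\<close>

fun row :: "nat \<Rightarrow> nat" where
  "row x = (if x = 0 then 0 else (3 * row (x div 3) + x mod 3) div 2)"

declare row.simps [simp del]

lemma row_0 [simp]: "row 0 = 0"
  by (simp add: row.simps)

lemma row_rec: "d < 3 \<Longrightarrow> row (3 * y + d) = (3 * row y + d) div 2"
  by (cases "3 * y + d = 0") (simp_all add: row.simps[of "3 * y + d"])

lemma ternary_digit_induct [case_names zero digit]:
  fixes x :: nat
  assumes "P 0" and "\<And>y d. P y \<Longrightarrow> y < 3 * y + d \<Longrightarrow> d < 3 \<Longrightarrow> P (3 * y + d)"
  shows "P x"
proof (induction x rule: less_induct)
  case (less x)
  show ?case
  proof (cases "x = 0")
    case False
    have "P (3 * (x div 3) + x mod 3)"
      by (rule assms(2)) (use less False in auto)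
    then show ?thesis by simp
  qed (use assms(1) in simp)
qed

text \<open>\<open>add_two\<close> read on base-3 values. Leading zeros do not change the value, so
  a string without the digit \<open>0\<close> needs no separate case.\<close>

fun add_two_value :: "nat \<Rightarrow> nat" where
  "add_two_value x =
    (if x mod 3 = 0 then x + 2 else 3 * add_two_value (x div 3) + (x mod 3 - 1))"

declare add_two_value.simps [simp del]

lemma add_two_value_rec:
  "add_two_value (3 * y) = 3 * y + 2"
  "d < 2 \<Longrightarrow> add_two_value (3 * y + Suc d) = 3 * add_two_value y + d"
proof -
  assume "d < 2"
  then have "(3 * y + Suc d) div 3 = y" "(3 * y + Suc d) mod 3 = Suc d" by presburger+
  then show "add_two_value (3 * y + Suc d) = 3 * add_two_value y + d"
    using add_two_value.simps[of "3 * y + Suc d"] by simp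
qed (simp add: add_two_value.simps[of "3 * y"])

lemma str_value_3_add_two:
  "set w \<subseteq> {0, 1, 2} \<Longrightarrow> str_value 3 (add_two w) = add_two_value (str_value 3 w)"
proof (induction w)
  case Nil
  show ?case using add_two_value_rec(1)[of 0] by (simp add: add_two_simps)
next
  case (Cons d w)
  then have "d = 0 \<or> d = Suc 0 \<or> d = Suc 1" by auto
  then show ?case
    using Cons add_two_value_rec(1)[of "str_value 3 w"]
      add_two_value_rec(2)[of 0 "str_value 3 w"] add_two_value_rec(2)[of 1 "str_value 3 w"]
    by (auto simp: add_two_simps)
qed

text \<open>Turning a last digit \<open>0\<close> into \<open>2\<close>, or lowering a nonzero one
  by one while \<open>row y\<close> grows by one, raises \<open>3 * row y + d\<close> by exactly
  two.\<close>

lemma row_add_two_value: "row (add_two_value x) = Suc (row x)"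
proof (induction x rule: ternary_digit_induct)
  case zero
  show ?case using add_two_value_rec(1)[of 0] row_rec[of 2 0] by simp
next
  case (digit y d)
  show ?case
  proof (cases d)
    case 0
    then show ?thesis using row_rec[of 2 y] row_rec[of 0 y] by (simp add: add_two_value_rec)
  next
    case (Suc c)
    then show ?thesis using digit by (simp add: add_two_value_rec row_rec del: add_Suc_right)
  qed
qed

text \<open>A last digit \<open>2\<close> can come from a \<open>0\<close>; a smaller
  \<open>d\<close> forces \<open>row y\<close> to be positive, so a preimage of \<open>y\<close>
  followed by \<open>d + 1\<close> works.\<close>

lemma ex_add_two_value: "row x = Suc i \<Longrightarrow> \<exists>y. row y = i \<and> x = add_two_value y"
proof -
  have "row x \<noteq> 0 \<Longrightarrow> \<exists>y. x = add_two_value y"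
  proof (induction x rule: ternary_digit_induct)
    case (digit y d)
    show ?case
    proof (cases "d = 2")
      case True
      then show ?thesis using add_two_value_rec(1)[of y] by metis
    next
      case False
      with digit have "d < 2" "row y \<noteq> 0" by (auto simp: row_rec)
      with digit obtain z where "y = add_two_value z" by auto
      then show ?thesis using add_two_value_rec(2)[OF \<open>d < 2\<close>, of z] by metis
    qed
  qed simp
  then show "row x = Suc i \<Longrightarrow> \<exists>y. row y = i \<and> x = add_two_value y"
    by (metis row_add_two_value nat.inject nat.distinct(1))
qed

lemma row_str_value_binary: "row (str_value 3 (binary k)) = 0"
proof (induction k rule: binary.induct)
  case (1 n)
  show ?case
  proof (cases "n < 2")
    case True
    then show ?thesis using row_rec[of n 0] by (subst binary.simps) simp
  next
    case False
    then show ?thesis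
      using 1 row_rec[of "n mod 2" "str_value 3 (binary (n div 2))"]
      by (subst binary.simps) (simp add: add.commute)
  qed
qed

lemma ex_str_value_binary: "row x = 0 \<Longrightarrow> \<exists>k. x = str_value 3 (binary k)"
proof (induction x rule: ternary_digit_induct)
  case zero
  show ?case by (rule exI[of _ 0], subst binary.simps) simp
next
  case (digit y d)
  then have d: "d < 2" and "row y = 0" by (auto simp: row_rec)
  with digit obtain k where k: "y = str_value 3 (binary k)" by auto
  have "3 * y + d = str_value 3 (binary (2 * k + d))"
    using d k by (cases "k = 0")
      (auto simp: binary.simps[of "2 * k + d"] binary.simps[of 0] binary.simps[of d])
  then show ?case ..
qed

lemma range_str_value_grid: "range (\<lambda>k. str_value 3 (grid i k)) = {x. row x = i}"
proof (induction i)
  case 0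
  show ?case using row_str_value_binary ex_str_value_binary by (fastforce simp: image_iff)
next
  case (Suc i)
  have "range (\<lambda>k. str_value 3 (grid (Suc i) k))
      = add_two_value ` range (\<lambda>k. str_value 3 (grid i k))"
    by (simp add: str_value_3_add_two[OF set_grid] image_image)
  also have "\<dots> = {x. row x = Suc i}"
    unfolding Suc using row_add_two_value ex_add_two_value by fastforce
  finally show ?case .
qed

lemma row_values_eq: "row_values i = int ` {x. row x = i}"
proof -
  have "str_value (3 :: int) w = int (str_value 3 w)" for w
    by (induction w) auto
  then show ?thesis
    unfolding row_values_def range_str_value_grid[symmetric] by auto
qed

text \<open>
  Here \<open>e\<close> is the carry left by the digits already split off, and \<open>c \<in> {0, 1}\<close> tells
  whether \<open>a = x\<close> is allowed, which is the case when those digits already make \<open>a\<close> the smaller one.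
\<close>

definition progression :: "nat \<Rightarrow> int \<Rightarrow> nat \<Rightarrow> nat \<Rightarrow> nat \<Rightarrow> bool" where
  "progression c e p q x \<longleftrightarrow>
    (\<exists>a b. row a = p \<and> row b = q \<and> a < x + c \<and> int a + int x = 2 * int b + e)"

text \<open>The number \<open>m = 3 * row (a div 3) + a mod 3\<close> records both the last digit of
  \<open>a\<close> and the row of the rest, and \<open>row a = m div 2\<close> leaves two candidates
  for it; likewise \<open>n\<close> for \<open>b\<close>. The quotient by 3 is the new
  carry.\<close>

lemma progression_digit:
  assumes "d < 3"
  shows "progression 0 e p q (3 * x + d) \<longleftrightarrow>
    (\<exists>m \<in> {2 * p, 2 * p + 1}. \<exists>n \<in> {2 * q, 2 * q + 1}.
      3 dvd 2 * int (n mod 3) + e - int (m mod 3) - int d \<and>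
      progression (of_bool (m mod 3 < d)) ((2 * int (n mod 3) + e - int (m mod 3) - int d) div 3)
        (m div 3) (n div 3) x)" (is "?L \<longleftrightarrow> ?R")
proof
  assume ?L
  then obtain a b where ab: "row a = p" "row b = q" "a < 3 * x + d"
    "int a + int (3 * x + d) = 2 * int b + e"
    by (auto simp: progression_def)
  define m n where "m = 3 * row (a div 3) + a mod 3" and "n = 3 * row (b div 3) + b mod 3"
  have mn: "m mod 3 = a mod 3" "m div 3 = row (a div 3)" "n mod 3 = b mod 3"
      "n div 3 = row (b div 3)"
    by (simp_all add: m_def n_def)
  have "row a = m div 2" "row b = n div 2"
    using row_rec[of "a mod 3" "a div 3"] row_rec[of "b mod 3" "b div 3"]
    by (simp_all add: m_def n_def)
  then have 1: "m \<in> {2 * p, 2 * p + 1}" "n \<in> {2 * q, 2 * q + 1}"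
    using ab by auto
  have 2: "a div 3 < x + of_bool (a mod 3 < d)"
    using ab(3) assms by (auto simp: of_bool_def) presburger+
  define f where "f = int (a div 3) + int x - 2 * int (b div 3)"
  have "int a = 3 * int (a div 3) + int (a mod 3)" "int b = 3 * int (b div 3) + int (b mod 3)"
    by presburger+
  with ab(4) have 3: "2 * int (n mod 3) + e - int (m mod 3) - int d = 3 * f"
    unfolding mn f_def by simp
  have "progression (of_bool (m mod 3 < d)) f (m div 3) (n div 3) x"
    unfolding progression_def mn using 2
    by (intro exI[of _ "a div 3"] exI[of _ "b div 3"]) (auto simp: f_def)
  with 1 3 show ?R by (metis dvd_triv_left nonzero_mult_div_cancel_left zero_neq_numeral)
next
  assume ?R
  then obtain m n f where 1: "m \<in> {2 * p, 2 * p + 1}" "n \<in> {2 * q, 2 * q + 1}"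
    "2 * int (n mod 3) + e - int (m mod 3) - int d = 3 * f"
    "progression (of_bool (m mod 3 < d)) f (m div 3) (n div 3) x"
    by (metis dvd_mult_div_cancel)
  then obtain a b where ab: "row a = m div 3" "row b = n div 3" "a < x + of_bool (m mod 3 < d)"
    "int a + int x = 2 * int b + f"
    by (auto simp: progression_def)
  have "row (3 * a + m mod 3) = p" "row (3 * b + n mod 3) = q"
    using 1(1,2) ab(1,2) by (auto simp: row_rec)
  moreover have "3 * a + m mod 3 < 3 * x + d"
    using ab(3) mod_less_divisor[of 3 m] by (auto simp: of_bool_def split: if_splits)
  ultimately show ?L
    unfolding progression_def using ab(4) 1(3)
    by (intro exI[of _ "3 * a + m mod 3"] exI[of _ "3 * b + n mod 3"]) auto
qed

text \<open>The only new candidate is \<open>a = x\<close>: it forces \<open>b = x\<close> if the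
  carry is 0, and parity excludes it if the carry is odd.\<close>

lemma progression_1:
  "progression 1 0 p q x \<longleftrightarrow> progression 0 0 p q x \<or> p = row x \<and> q = row x"
  "odd e \<Longrightarrow> progression 1 e p q x \<longleftrightarrow> progression 0 e p q x"
proof -
  show "progression 1 0 p q x \<longleftrightarrow> progression 0 0 p q x \<or> p = row x \<and> q = row x"
    by (auto simp: progression_def less_Suc_eq)
  assume "odd e"
  then have "int x + int x \<noteq> 2 * int b + e" for b
    by presburger
  then show "progression 1 e p q x \<longleftrightarrow> progression 0 e p q x"
    by (auto simp: progression_def less_Suc_eq)
qed

text \<open>
  The first conjunct is the theorem; the other five make the family stable under splitting off
  the last digit of \<open>x\<close>. They were found by a subset construction: each conjunct is a set of
  pairs of a carry and two rows, at least one of which is realised, and every digit step leads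
  from such a set, up to a shift of \<open>p\<close>, to a superset of another one or to the first conjunct.
\<close>

definition solvable :: "nat \<Rightarrow> nat \<Rightarrow> bool" where
  "solvable p x \<longleftrightarrow>
    progression 0 0 p p x \<and>
    (progression 0 (-1) p (p+1) x \<or> progression 0 1 (p+1) p x) \<and>
    (progression 0 1 p p x \<or> progression 0 1 (p+1) p x) \<and>
    (progression 0 (-1) p (p+1) x \<or> progression 0 (-1) (p+1) (p+1) x) \<and>
    (progression 0 (-1) p (p+1) x \<or> progression 0 0 p (p+1) x \<or>
      progression 0 0 (p+1) (p+1) x) \<and>
    (progression 0 0 p (p+1) x \<or> progression 0 0 (p+1) (p+1) x \<or> progression 0 1 p p x)"

lemma solvable_digit:
  assumes IH: "\<And>p. p < row x \<Longrightarrow> solvable p x" and "d < 3" and p: "p < row (3 * x + d)"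
  shows "solvable p (3 * x + d)"
proof -
  define m where "m = p div 3"
  have r: "p = 3 * m \<or> p = 3 * m + 1 \<or> p = 3 * m + 2" unfolding m_def by presburger
  have d: "d = 0 \<or> d = 1 \<or> d = 2" using assms by auto
  have div_mod: "6 * m div 3 = 2 * m" "6 * m mod 3 = 0"
      "(k + 6 * m) div 3 = k div 3 + 2 * m" "(k + 6 * m) mod 3 = k mod 3" for k
    by presburger+
  have "2 * p + 2 \<le> 3 * row x + d"
    using p \<open>d < 3\<close> by (simp add: row_rec)
  \<comment> \<open>The shorter strings lie in rows \<open>2 * m\<close> to
    \<open>2 * m + 2\<close>. \<open>IH\<close> covers \<open>p\<close> below \<open>row x\<close>;
    for \<open>p\<close> equal to \<open>row x\<close>, the trivial solution
    \<open>a = b = x\<close> from \<open>progression_1\<close> is available.\<close>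
  then have bound: "2 * m = row x \<or> 2 * m < row x"
      "d < 2 \<or> p \<noteq> 3 * m \<Longrightarrow> 2 * m < row x \<and> (2 * m + 1 = row x \<or> 2 * m + 1 < row x)"
      "p = 3 * m + 2 \<or> p = 3 * m + 1 \<and> d = 0 \<Longrightarrow>
        2 * m + 1 < row x \<and> (2 * m + 2 = row x \<or> 2 * m + 2 < row x)"
    using r \<open>d < 3\<close> by auto
  note facts = bound IH[of "2 * m"] IH[of "2 * m + 1"] IH[of "2 * m + 2"]
  note rules = solvable_def progression_digit[where d = 0, simplified]
    progression_digit[where d = 1, simplified] progression_digit[where d = 2, simplified]
    div_mod div_Suc mod_Suc progression_1[unfolded One_nat_def]
  show ?thesis
    using r d by (elim disjE; use facts in \<open>simp add: rules; blast\<close>)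
qed

lemma solvable_less_row: "p < row x \<Longrightarrow> solvable p x"
proof (induction x arbitrary: p rule: ternary_digit_induct)
  case (digit y d)
  then show ?case using solvable_digit by blast
qed simp

theorem theorem11:
  fixes i j :: nat and x :: int
  assumes "j < i"
    and "x \<in> row_values i"
  shows "\<exists>a \<in> row_values j. \<exists>b \<in> row_values j. a < b \<and> b < x \<and> b - a = x - b"
proof -
  obtain y where y: "x = int y" "row y = i"
    using assms(2) by (auto simp: row_values_eq)
  then have "solvable j y"
    using solvable_less_row assms(1) by blast
  then obtain a b where "row a = j" "row b = j" "a < y" "int a + int y = 2 * int b"
    by (auto simp: solvable_def progression_def)
  then show ?thesis
    unfolding row_values_eq y(1)
    by (intro bexI[of _ "int a"] bexI[of _ "int b"]) auto
qed

end
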